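(* Let $n,q$ be positive integers with $n\ge6$, $q\ge2$. Any $5$-design $C$ in $H(n,q)$ with degree $3$ and degree set $\{a,n-a,n\}$ for some integer $a$ with $a<n/2$ is isomorphic to the dual of the binary repetition code of length $6$ (i.e., the set of all binary vectors of length $6$ of even weight).
   Context: $[q]=\{1,\ldots,q\}$; $\partial$ is Hamming distance. A nonempty $C\subseteq[q]^n$ is a $t$-design in the Hamming scheme $H(n,q)$ if the array of its elements (as rows) is an orthogonal array of strength $t$: in any $t$ columns every element of $[q]^t$ occurs equally often. Its degree set is $\{\partial(x,y):x,y\in C,x\ne y\}$ and its degree is the size of that set. Two codes are isomorphic if one is obtained from the other by permuting coordinates and permuting symbols within each coordinate. *)

theory Defs
  imports Complex_Main "HOL-Library.FuncSet" "HOL-Library.Z2" "HOL-Combinatorics.Permutations"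
begin

definition words :: "nat \<Rightarrow> nat \<Rightarrow> (nat \<Rightarrow> nat) set" where
  "words n q = {1..n} \<rightarrow>\<^sub>E {1..q}"

definition hamming_dist :: "nat \<Rightarrow> (nat \<Rightarrow> 'a) \<Rightarrow> (nat \<Rightarrow> 'a) \<Rightarrow> nat" where
  "hamming_dist n x y = card {i \<in> {1..n}. x i \<noteq> y i}"

text \<open>A choice of \<open>t\<close> columns is a \<open>t\<close>-element set \<open>T\<close> of coordinates, and the entries of
  the row \<open>x\<close> in these columns are \<open>restrict x T\<close>.\<close>

definition orthogonal_array :: "nat \<Rightarrow> nat \<Rightarrow> nat \<Rightarrow> (nat \<Rightarrow> nat) set \<Rightarrow> bool" where
  "orthogonal_array t n q C \<longleftrightarrow>
     (\<forall>T. T \<subseteq> {1..n} \<and> card T = t \<longrightarrow>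
        (\<exists>m::nat. \<forall>z \<in> T \<rightarrow>\<^sub>E {1..q}. card {x \<in> C. restrict x T = z} = m))"

definition hamming_design :: "nat \<Rightarrow> nat \<Rightarrow> nat \<Rightarrow> (nat \<Rightarrow> nat) set \<Rightarrow> bool" where
  "hamming_design t n q C \<longleftrightarrow> C \<noteq> {} \<and> C \<subseteq> words n q \<and> orthogonal_array t n q C"

definition degree_set :: "nat \<Rightarrow> (nat \<Rightarrow> 'a) set \<Rightarrow> nat set" where
  "degree_set n C = {hamming_dist n x y | x y. x \<in> C \<and> y \<in> C \<and> x \<noteq> y}"

definition code_degree :: "nat \<Rightarrow> (nat \<Rightarrow> 'a) set \<Rightarrow> nat" where
  "code_degree n C = card (degree_set n C)"

definition code_isomorphic :: "nat \<Rightarrow> nat \<Rightarrow> (nat \<Rightarrow> nat) set \<Rightarrow> (nat \<Rightarrow> nat) set \<Rightarrow> bool" where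
  "code_isomorphic n q C D \<longleftrightarrow>
     (\<exists>\<pi> \<sigma>. \<pi> permutes {1..n} \<and> (\<forall>i\<in>{1..n}. \<sigma> i permutes {1..q}) \<and>
        D = (\<lambda>x. \<lambda>i\<in>{1..n}. \<sigma> i (x (\<pi> i))) ` C)"

definition binary_words :: "nat \<Rightarrow> (nat \<Rightarrow> bit) set" where
  "binary_words n = {1..n} \<rightarrow>\<^sub>E UNIV"

definition binary_repetition_code :: "nat \<Rightarrow> (nat \<Rightarrow> bit) set" where
  "binary_repetition_code n = range (\<lambda>b. \<lambda>i\<in>{1..n}. b)"

definition dual_code :: "nat \<Rightarrow> (nat \<Rightarrow> bit) set \<Rightarrow> (nat \<Rightarrow> bit) set" where
  "dual_code n D = {x \<in> binary_words n. \<forall>y\<in>D. (\<Sum>i=1..n. x i * y i) = 0}"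

text \<open>Codes over the two-element field become codes over the alphabet \<open>{1, 2}\<close> by renaming the
  symbol \<open>0\<close> to \<open>1\<close> and the symbol \<open>1\<close> to \<open>2\<close>; up to isomorphism of codes the choice of the
  renaming is irrelevant.\<close>

definition symbol_of_bit :: "bit \<Rightarrow> nat" where
  "symbol_of_bit b = (if b = 0 then 1 else 2)"

definition relabel :: "nat \<Rightarrow> (nat \<Rightarrow> bit) set \<Rightarrow> (nat \<Rightarrow> nat) set" where
  "relabel n D = (\<lambda>x. \<lambda>i\<in>{1..n}. symbol_of_bit (x i)) ` D"

lemma sum_bit_eq_0_iff:
  fixes f :: "'a \<Rightarrow> bit"
  assumes "finite A"
  shows "sum f A = 0 \<longleftrightarrow> even (card {i \<in> A. f i = 1})"
  using assms
proof (induction A rule: finite_induct)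
  case empty
  then show ?case by simp
next
  case (insert a A)
  show ?case
  proof (cases "f a = 1")
    case True
    then have "{i \<in> insert a A. f i = 1} = insert a {i \<in> A. f i = 1}" by auto
    moreover have "a \<notin> {i \<in> A. f i = 1}" using insert by simp
    moreover have "1 + s = 0 \<longleftrightarrow> s \<noteq> 0" for s :: bit by (cases s) simp_all
    ultimately show ?thesis using insert True
      by (simp del: add_bit_eq_xor bit_not_zero_iff)
  next
    case False
    then have "{i \<in> insert a A. f i = 1} = {i \<in> A. f i = 1}" by auto
    then show ?thesis using insert False by simp
  qed
qed

lemma dual_binary_repetition_code:
  "dual_code n (binary_repetition_code n) =
     {x \<in> binary_words n. even (card {i \<in> {1..n}. x i = 1})}"
proof -
  have "(\<forall>y\<in>binary_repetition_code n. (\<Sum>i=1..n. x i * y i) = 0) \<longleftrightarrow> (\<Sum>i=1..n. x i) = 0"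
    for x :: "nat \<Rightarrow> bit"
  proof -
    have "(\<Sum>i=1..n. x i * (\<lambda>i\<in>{1..n}. b) i) = (\<Sum>i=1..n. x i) * b" for b
      unfolding sum_distrib_right by (rule sum.cong) auto
    then have "(\<forall>y\<in>binary_repetition_code n. (\<Sum>i=1..n. x i * y i) = 0)
        \<longleftrightarrow> (\<forall>b. (\<Sum>i=1..n. x i) * b = 0)"
      unfolding binary_repetition_code_def by (simp only: ball_simps)
    also have "\<dots> \<longleftrightarrow> (\<Sum>i=1..n. x i) = 0"
      by (metis mult.right_neutral mult_zero_left)
    finally show ?thesis .
  qed
  then show ?thesis
    unfolding dual_code_def by (simp only: sum_bit_eq_0_iff finite_atLeastAtMost)
qed

end

theory Submission
  imports Defs
begin

text \<open>
  Fix \<open>x \<in> C\<close> and let \<open>w\<close> be the number of coordinates in which a codeword agrees with \<open>x\<close>.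
  Strength 5 says that the average of every polynomial of degree at most 5 in \<open>w\<close> over \<open>C\<close> is its
  mean under the binomial distribution with parameters \<open>n\<close> and \<open>1 / q\<close>. As \<open>w\<close> only takes the
  values \<open>0\<close>, \<open>a\<close>, \<open>n - a\<close>, \<open>n\<close>, this is a Gauss--Lobatto quadrature, so \<open>a - 1\<close> and \<open>n - a - 1\<close>
  are the roots of the quadratic orthogonal polynomial of the binomial distribution with parameters
  \<open>n - 2\<close> and \<open>1 / q\<close>. Their sum is \<open>n - 2\<close>, which forces \<open>q = 2\<close>; then \<open>k = n - 2 a\<close> satisfies
  \<open>k\<^sup>2 = n - 2\<close>, and \<open>C\<close> has \<open>n\<^sup>2 - n + 2\<close> elements and is closed under complements.

  Writing codewords as sign vectors, \<open>C\<close> becomes a set of equiangular lines with inner products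
  \<open>\<plusminus> k\<close>. By strength 2, the products \<open>\<langle>x, z\<rangle> \<langle>z, y\<rangle>\<close> summed over \<open>z \<in> C\<close> give \<open>card C\<close> times
  \<open>\<langle>x, y\<rangle>\<close>. Modulo \<open>k\<^sup>2\<close> only \<open>z = \<plusminus> x, \<plusminus> y\<close> contribute, whence \<open>k\<close> divides \<open>card C - 4 n\<close> and
  therefore 4. Since 32 divides \<open>card C\<close>, only \<open>k = 2\<close> and \<open>n = 6\<close> remain. All distances are then
  even, and five coordinates determine the sixth.
\<close>

section \<open>Agreement numbers of words\<close>

text \<open>Agreement is preferred to distance because \<open>agreement n x z choose j\<close>
  counts the \<open>j\<close>-sets of columns on which \<open>z\<close> coincides with
  \<open>x\<close>, and strength controls exactly these.\<close>

definition agreement :: "nat \<Rightarrow> (nat \<Rightarrow> 'a) \<Rightarrow> (nat \<Rightarrow> 'a) \<Rightarrow> nat" where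
  "agreement n x y = card {i \<in> {1..n}. x i = y i}"

lemma agreement_add_hamming_dist: "agreement n x y + hamming_dist n x y = n"
proof -
  have "card ({i \<in> {1..n}. x i = y i} \<union> {i \<in> {1..n}. x i \<noteq> y i})
      = agreement n x y + hamming_dist n x y"
    unfolding agreement_def hamming_dist_def by (rule card_Un_disjoint) auto
  moreover have "{i \<in> {1..n}. x i = y i} \<union> {i \<in> {1..n}. x i \<noteq> y i} = {1..n}" by auto
  ultimately show ?thesis by simp
qed

lemma agreement_commute: "agreement n x y = agreement n y x"
  unfolding agreement_def by (rule arg_cong[where f = card]) auto

lemma agreement_self: "agreement n x x = n"
  using agreement_add_hamming_dist[of n x x] by (simp add: hamming_dist_def)

lemma agreement_eq_length_iff:
  assumes "x \<in> words n q" "y \<in> words n q"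
  shows "agreement n x y = n \<longleftrightarrow> x = y"
proof
  assume "agreement n x y = n"
  then have "card {i \<in> {1..n}. x i = y i} = card {1..n}" unfolding agreement_def by simp
  then have "{i \<in> {1..n}. x i = y i} = {1..n}" by (intro card_subset_eq) auto
  then have "x i = y i" if "i \<in> {1..n}" for i using that by blast
  then show "x = y" using assms unfolding words_def by (rule PiE_ext[rotated 2])
qed (simp add: agreement_self)

lemma words_symbolD: "x \<in> words n q \<Longrightarrow> i \<in> {1..n} \<Longrightarrow> x i \<in> {1..q}"
  unfolding words_def by (rule PiE_mem)

lemma words_undefined: "x \<in> words n q \<Longrightarrow> i \<notin> {1..n} \<Longrightarrow> x i = undefined"
  unfolding words_def by (rule PiE_arb)

section \<open>Counting consequences of strength\<close>

lemma design_finite: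
  assumes "hamming_design t n q C"
  shows "finite C"
proof (rule finite_subset)
  show "C \<subseteq> words n q" using assms unfolding hamming_design_def by simp
  show "finite (words n q)" unfolding words_def by (intro finite_PiE) auto
qed

lemma design_wordD: "hamming_design t n q C \<Longrightarrow> x \<in> C \<Longrightarrow> x \<in> words n q"
  unfolding hamming_design_def by auto

lemma design_symbolD: "hamming_design t n q C \<Longrightarrow> x \<in> C \<Longrightarrow> i \<in> {1..n} \<Longrightarrow> x i \<in> {1..q}"
  using words_symbolD[OF design_wordD] .

text \<open>The definition only provides some common multiplicity \<open>m\<close>; summing over all
  \<open>q ^ t\<close> patterns on \<open>T\<close> identifies it through
  \<open>card C = m * q ^ t\<close>.\<close>

lemma design_count_full:
  assumes D: "hamming_design t n q C" and T: "T \<subseteq> {1..n}" "card T = t"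
    and u: "\<And>i. i \<in> T \<Longrightarrow> u i \<in> {1..q}"
  shows "card {z \<in> C. \<forall>i\<in>T. z i = u i} * q ^ t = card C"
proof -
  have finT: "finite T" using T(1) finite_subset by blast
  have "\<exists>m. \<forall>z \<in> T \<rightarrow>\<^sub>E {1..q}. card {x \<in> C. restrict x T = z} = m"
    using D T unfolding hamming_design_def orthogonal_array_def by blast
  then obtain m where m: "\<And>z. z \<in> T \<rightarrow>\<^sub>E {1..q} \<Longrightarrow> card {x \<in> C. restrict x T = z} = m"
    by blast
  have "restrict z T \<in> T \<rightarrow>\<^sub>E {1..q}" if "z \<in> C" for z
    using design_symbolD[OF D that] T(1) by auto
  then have "(\<lambda>z. restrict z T) ` C \<subseteq> T \<rightarrow>\<^sub>E {1..q}" by blast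
  then have "card C = (\<Sum>z\<in>T \<rightarrow>\<^sub>E {1..q}. card {x \<in> C. restrict x T = z})"
    using sum.group[of C "T \<rightarrow>\<^sub>E {1..q}" "\<lambda>x. restrict x T" "\<lambda>_. 1::nat"]
      design_finite[OF D] finite_PiE[OF finT, of "\<lambda>_. {1..q}"] by simp
  also have "\<dots> = m * q ^ t" using m T(2) finT by (simp add: card_PiE)
  finally have "card C = m * q ^ t" .
  moreover have "{z \<in> C. \<forall>i\<in>T. z i = u i} = {x \<in> C. restrict x T = restrict u T}"
    by (auto simp: restrict_def fun_eq_iff)
  moreover have "restrict u T \<in> T \<rightarrow>\<^sub>E {1..q}" using u by auto
  ultimately show ?thesis using m by simp
qed

text \<open>Strength passes down to smaller column sets: fix one further column and sum over its
  \<open>q\<close> symbols. The assumption \<open>t \<le> n\<close> guarantees that a further column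
  exists.\<close>

lemma design_count:
  assumes D: "hamming_design t n q C" and "t \<le> n" and "T \<subseteq> {1..n}" "card T \<le> t"
    and "\<And>i. i \<in> T \<Longrightarrow> u i \<in> {1..q}"
  shows "card {z \<in> C. \<forall>i\<in>T. z i = u i} * q ^ card T = card C"
  using assms(3-)
proof (induction "t - card T" arbitrary: T u)
  case 0
  then show ?case using design_count_full[OF D, of T u] by simp
next
  case (Suc d)
  have finT: "finite T" using Suc.prems(1) finite_subset by blast
  have "card T < card {1..n}" using Suc.hyps(2) \<open>t \<le> n\<close> by simp
  then obtain i where i: "i \<in> {1..n}" "i \<notin> T"
    by (metis card_mono finT leD subsetI)
  have step: "card {z \<in> C. \<forall>j\<in>insert i T. z j = (u(i := c)) j} * q ^ card (insert i T) = card C"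
    if "c \<in> {1..q}" for c
    by (rule Suc.hyps(1)) (use Suc i finT that in auto)
  have "card {z \<in> C. \<forall>j\<in>T. z j = u j}
      = (\<Sum>c\<in>{1..q}. card {z \<in> {z \<in> C. \<forall>j\<in>T. z j = u j}. z i = c})"
    using sum.group[of "{z \<in> C. \<forall>j\<in>T. z j = u j}" "{1..q}" "\<lambda>z. z i" "\<lambda>_. 1::nat"]
      design_finite[OF D] design_symbolD[OF D _ i(1)] by (auto simp: image_subset_iff)
  also have "\<dots> = (\<Sum>c\<in>{1..q}. card {z \<in> C. \<forall>j\<in>insert i T. z j = (u(i := c)) j})"
    by (intro sum.cong arg_cong[where f = card]) (use i in auto)
  finally have "card {z \<in> C. \<forall>j\<in>T. z j = u j} * q ^ card (insert i T)
      = (\<Sum>c\<in>{1..q}. card C)"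
    using step by (simp add: sum_distrib_right)
  \<comment> \<open>Needed to cancel the additional factor \<open>q\<close> on both sides.\<close>
  moreover have "q > 0"
  proof -
    obtain z where "z \<in> C" using D unfolding hamming_design_def by auto
    from design_symbolD[OF D this i(1)] show ?thesis by auto
  qed
  ultimately show ?case using i finT by simp
qed

text \<open>Double counting of pairs of a codeword \<open>z\<close> and a \<open>j\<close>-set
  \<open>T\<close> on which \<open>z\<close> agrees with \<open>x\<close>; each \<open>T\<close>
  lies in \<open>card C / q ^ j\<close> such pairs.\<close>

lemma sum_agreement_choose:
  assumes D: "hamming_design t n q C" and "t \<le> n" and x: "x \<in> C" and j: "j \<le> t"
  shows "(\<Sum>z\<in>C. agreement n x z choose j) * q ^ j = (n choose j) * card C"
proof -
  let ?F = "{T. T \<subseteq> {1..n} \<and> card T = j}"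
  have finF: "finite ?F" by simp
  have "agreement n x z choose j = (\<Sum>T\<in>?F. if \<forall>i\<in>T. z i = x i then 1 else 0)" for z
  proof -
    have "agreement n x z choose j = card {T. T \<subseteq> {i \<in> {1..n}. x i = z i} \<and> card T = j}"
      unfolding agreement_def by (simp add: n_subsets)
    also have "\<dots> = card {T \<in> ?F. \<forall>i\<in>T. z i = x i}"
      by (rule arg_cong[where f = card]) (auto simp: subset_iff)
    also have "\<dots> = (\<Sum>T\<in>?F. if \<forall>i\<in>T. z i = x i then 1 else 0)"
      using finF by (simp add: sum.If_cases Int_def)
    finally show ?thesis .
  qed
  then have "(\<Sum>z\<in>C. agreement n x z choose j)
      = (\<Sum>z\<in>C. \<Sum>T\<in>?F. if \<forall>i\<in>T. z i = x i then 1 else 0)" by simp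
  also have "\<dots> = (\<Sum>T\<in>?F. \<Sum>z\<in>C. if \<forall>i\<in>T. z i = x i then 1 else 0)"
    by (rule sum.swap)
  also have "\<dots> = (\<Sum>T\<in>?F. card {z \<in> C. \<forall>i\<in>T. z i = x i})"
    using design_finite[OF D] by (simp add: sum.If_cases Int_def)
  finally have "(\<Sum>z\<in>C. agreement n x z choose j) * q ^ j
      = (\<Sum>T\<in>?F. card {z \<in> C. \<forall>i\<in>T. z i = x i} * q ^ j)" by (simp add: sum_distrib_right)
  also have "\<dots> = (\<Sum>T\<in>?F. card C)"
  proof (rule sum.cong)
    fix T assume "T \<in> ?F"
    then have T: "T \<subseteq> {1..n}" "card T = j" by auto
    have "card {z \<in> C. \<forall>i\<in>T. z i = x i} * q ^ card T = card C"
      by (rule design_count[OF D \<open>t \<le> n\<close> T(1)])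
        (use T j design_symbolD[OF D x] in \<open>blast | simp\<close>)+
    then show "card {z \<in> C. \<forall>i\<in>T. z i = x i} * q ^ j = card C" using T(2) by simp
  qed simp
  also have "\<dots> = (n choose j) * card C" by (simp add: n_subsets)
  finally show ?thesis .
qed

text \<open>Multiplying by \<open>j!\<close> turns the binomial moments into falling factorials,
  which are polynomials in the agreement number.\<close>

lemma sum_agreement_falling:
  assumes D: "hamming_design t n q C" and "t \<le> n" and x: "x \<in> C" and j: "j \<le> t"
  shows "(\<Sum>z\<in>C. \<Prod>i<j. real (agreement n x z) - real i) * real q ^ j
    = (\<Prod>i<j. real n - real i) * real (card C)"
proof -
  have falling: "(\<Prod>i<j. real m - real i) = fact j * real (m choose j)" for m
    by (simp add: binomial_gbinomial gbinomial_prod_rev atLeast0LessThan)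
  have "real ((\<Sum>z\<in>C. agreement n x z choose j) * q ^ j) = real ((n choose j) * card C)"
    using sum_agreement_choose[OF assms] by simp
  then show ?thesis unfolding falling by (simp add: sum_distrib_left[symmetric])
qed

text \<open>Counts triples \<open>(z, i, j)\<close> with \<open>z i = x i\<close> and
  \<open>z j = y j\<close>. A pair \<open>i \<noteq> j\<close> admits a quarter of the codewords;
  \<open>i = j\<close> admits half of them if \<open>x i = y i\<close> and none otherwise.\<close>

lemma sum_agreement_product:
  assumes D: "hamming_design t n 2 C" and "2 \<le> t" "t \<le> n" and x: "x \<in> C" and y: "y \<in> C"
  shows "4 * (\<Sum>z\<in>C. agreement n x z * agreement n y z)
    = (2 * agreement n x y + n * (n - 1)) * card C"
proof -
  have finC: "finite C" using design_finite[OF D] .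
  have cnt: "4 * card {z \<in> C. z i = x i \<and> z j = y j}
      = (if i = j then (if x i = y i then 2 * card C else 0) else card C)"
    if i: "i \<in> {1..n}" and j: "j \<in> {1..n}" for i j
  proof (cases "i = j")
    case True
    have "card {z \<in> C. z j = x j} * 2 = card C"
      using design_count[OF D \<open>t \<le> n\<close>, of "{j}" x] assms(2) j design_symbolD[OF D x j] by simp
    moreover have "card {z \<in> C. z i = x i \<and> z j = y j}
        = (if x j = y j then card {z \<in> C. z j = x j} else 0)"
    proof (cases "x j = y j")
      case True
      then show ?thesis using \<open>i = j\<close> by (auto intro: arg_cong[where f = card])
    next
      case False
      then have empty: "{z \<in> C. z i = x i \<and> z j = y j} = {}" using \<open>i = j\<close> by auto
      show ?thesis unfolding empty using False by simp
    qed
    ultimately show ?thesis using True by (simp split: if_splits)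
  next
    case False
    have "card {z \<in> C. \<forall>l\<in>{i, j}. z l = (x(j := y j)) l} * 2 ^ card {i, j} = card C"
      by (rule design_count[OF D \<open>t \<le> n\<close>])
        (use assms(2) i j False design_symbolD[OF D x] design_symbolD[OF D y] in auto)
    then show ?thesis using False by (simp add: ac_simps)
  qed
  have ag: "agreement n v z = (\<Sum>i\<in>{1..n}. if z i = v i then 1 else 0)" for v z :: "nat \<Rightarrow> nat"
  proof -
    have "{1..n} \<inter> {i. z i = v i} = {i \<in> {1..n}. v i = z i}" by auto
    then show ?thesis unfolding agreement_def by (simp add: sum.If_cases)
  qed
  have "(\<Sum>z\<in>C. agreement n x z * agreement n y z)
      = (\<Sum>z\<in>C. \<Sum>i\<in>{1..n}. \<Sum>j\<in>{1..n}. if z i = x i \<and> z j = y j then 1 else 0)"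
    unfolding ag sum_product by (intro sum.cong refl) auto
  also have "\<dots> = (\<Sum>i\<in>{1..n}. \<Sum>j\<in>{1..n}. \<Sum>z\<in>C. if z i = x i \<and> z j = y j then 1 else 0)"
    by (subst sum.swap, rule sum.cong[OF refl], rule sum.swap)
  also have "\<dots> = (\<Sum>i\<in>{1..n}. \<Sum>j\<in>{1..n}. card {z \<in> C. z i = x i \<and> z j = y j})"
    using finC by (simp add: sum.If_cases Int_def)
  finally have "4 * (\<Sum>z\<in>C. agreement n x z * agreement n y z)
      = (\<Sum>i\<in>{1..n}. \<Sum>j\<in>{1..n}. 4 * card {z \<in> C. z i = x i \<and> z j = y j})"
    by (simp add: sum_distrib_left)
  also have "\<dots> = (\<Sum>i\<in>{1..n}. \<Sum>j\<in>{1..n}.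
      if i = j then (if x i = y i then 2 * card C else 0) else card C)"
    by (intro sum.cong refl) (rule cnt)
  also have "\<dots> = (\<Sum>i\<in>{1..n}. (if y i = x i then 1 else 0) * (2 * card C) + (n - 1) * card C)"
  proof (rule sum.cong[OF refl])
    fix i assume i: "i \<in> {1..n}"
    show "(\<Sum>j\<in>{1..n}. if i = j then (if x i = y i then 2 * card C else 0) else card C)
      = (if y i = x i then 1 else 0) * (2 * card C) + (n - 1) * card C"
      using i by (subst sum.remove[OF _ i]) auto
  qed
  also have "\<dots> = agreement n x y * (2 * card C) + n * ((n - 1) * card C)"
    unfolding sum.distrib sum_distrib_right[symmetric] ag by simp
  finally show ?thesis by (simp add: algebra_simps)
qed

text \<open>Over two symbols \<open>x'\<close> is the complement of \<open>x\<close>, so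
  \<open>y\<close> agrees with it exactly where \<open>y\<close> differs from
  \<open>x\<close>.\<close>

lemma agreement_complement:
  assumes x: "x \<in> words n 2" and y: "y \<in> words n 2" and x': "x' \<in> words n 2"
    and 0: "agreement n x x' = 0"
  shows "agreement n y x' + agreement n y x = n"
proof -
  have ne: "x i \<noteq> x' i" if "i \<in> {1..n}" for i
    using 0 that unfolding agreement_def by auto
  have "y i = x' i \<longleftrightarrow> y i \<noteq> x i" if i: "i \<in> {1..n}" for i
  proof -
    have "x i \<in> {1..2}" "y i \<in> {1..2}" "x' i \<in> {1..2}"
      using words_symbolD x y x' i by blast+
    with ne[OF i] show ?thesis by auto
  qed
  then have "agreement n y x' = hamming_dist n y x"
    unfolding agreement_def hamming_dist_def by (intro arg_cong[where f = card]) auto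
  then show ?thesis using agreement_add_hamming_dist[of n y x] by simp
qed

section \<open>Quadrature and the parameters of the design\<close>

lemma sum_four_values:
  fixes g :: "nat \<Rightarrow> real"
  assumes "finite C" and "\<And>z. z \<in> C \<Longrightarrow> w z \<in> {v1, v2, v3, v4}" and "distinct [v1, v2, v3, v4]"
  shows "(\<Sum>z\<in>C. g (w z)) = card {z \<in> C. w z = v1} * g v1 + card {z \<in> C. w z = v2} * g v2
    + card {z \<in> C. w z = v3} * g v3 + card {z \<in> C. w z = v4} * g v4"
proof -
  have "(\<Sum>z\<in>C. g (w z)) = (\<Sum>z\<in>C. (if w z = v1 then g v1 else 0) + (if w z = v2 then g v2 else 0)
      + (if w z = v3 then g v3 else 0) + (if w z = v4 then g v4 else 0))"
  proof (rule sum.cong[OF refl])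
    fix z assume "z \<in> C"
    from assms(2)[OF this] consider "w z = v1" | "w z = v2" | "w z = v3" | "w z = v4" by blast
    then show "g (w z) = (if w z = v1 then g v1 else 0) + (if w z = v2 then g v2 else 0)
        + (if w z = v3 then g v3 else 0) + (if w z = v4 then g v4 else 0)"
      by cases (use assms(3) in simp_all)
  qed
  then show ?thesis using assms(1) by (simp add: sum.distrib sum.If_cases Int_def)
qed

text \<open>
  The equations \<open>e0\<close>--\<open>e5\<close> are the factorial moments of the weights \<open>1, \<alpha>, \<beta>, \<gamma>\<close> at the nodes
  \<open>n, b, a, 0\<close>. The auxiliary \<open>h0\<close>--\<open>h3\<close> are their combinations for the measure with density
  \<open>w (n - w)\<close>, which kills the end nodes and shifts the binomial distribution from \<open>n\<close> to \<open>n - 2\<close>.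
\<close>

lemma lobatto_parameters:
  fixes n a b q M \<alpha> \<beta> \<gamma> :: real
  assumes e0: "1 + \<alpha> + \<beta> + \<gamma> = M"
    and e1: "(n + \<alpha> * b + \<beta> * a) * q = n * M"
    and e2: "(n * (n - 1) + \<alpha> * (b * (b - 1)) + \<beta> * (a * (a - 1))) * q ^ 2 = n * (n - 1) * M"
    and e3: "(n * (n - 1) * (n - 2) + \<alpha> * (b * (b - 1) * (b - 2)) + \<beta> * (a * (a - 1) * (a - 2))) * q ^ 3
      = n * (n - 1) * (n - 2) * M"
    and e4: "(n * (n - 1) * (n - 2) * (n - 3) + \<alpha> * (b * (b - 1) * (b - 2) * (b - 3))
      + \<beta> * (a * (a - 1) * (a - 2) * (a - 3))) * q ^ 4 = n * (n - 1) * (n - 2) * (n - 3) * M"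
    and e5: "(n * (n - 1) * (n - 2) * (n - 3) * (n - 4) + \<alpha> * (b * (b - 1) * (b - 2) * (b - 3) * (b - 4))
      + \<beta> * (a * (a - 1) * (a - 2) * (a - 3) * (a - 4))) * q ^ 5
      = n * (n - 1) * (n - 2) * (n - 3) * (n - 4) * M"
    and ab: "a + b = n" "a < b" and n: "n \<ge> 6" and q: "q \<ge> 2" and M: "M > 0"
  shows "q = 2 \<and> (b - a) ^ 2 = n - 2 \<and> \<gamma> = 1 \<and> M = n ^ 2 - n + 2"
proof -
  \<comment> \<open>Since \<open>a + b = n\<close>, the density \<open>w (n - w)\<close> equals
    \<open>a * b\<close> at both inner nodes. \<open>K\<close> is \<open>q ^ 2\<close> times the
    total mass of the new measure.\<close>
  define A B K where "A = \<alpha> * a * b" and "B = \<beta> * a * b" and "K = n * (n - 1) * M * (q - 1)"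
  have K: "K > 0" unfolding K_def using n q M by simp
  have b: "b = n - a" using ab by simp
  have h0: "(A + B) * q ^ 2 = K"
    using e1 e2 unfolding A_def B_def K_def b by algebra
  have h1: "(A * (b - 1) + B * (a - 1)) * q ^ 3 = K * (n - 2)"
    using e2 e3 unfolding A_def B_def K_def b by algebra
  have h2: "(A * ((b - 1) * (b - 2)) + B * ((a - 1) * (a - 2))) * q ^ 4 = K * ((n - 2) * (n - 3))"
    using e3 e4 unfolding A_def B_def K_def b by algebra
  have h3: "(A * ((b - 1) * (b - 2) * (b - 3)) + B * ((a - 1) * (a - 2) * (a - 3))) * q ^ 5
      = K * ((n - 2) * (n - 3) * (n - 4))"
    using e4 e5 unfolding A_def B_def K_def b by algebra
  \<comment> \<open>Integrates \<open>(u - (a - 1)) (u - (b - 1))\<close> with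
    \<open>u = w - 1\<close>, expanded in falling factorials of \<open>u\<close>. It vanishes at
    both inner nodes, and the moments turn this into an equation in \<open>n\<close>,
    \<open>q\<close>, \<open>a\<close>, \<open>b\<close>.\<close>
  have "K * ((a - 1) * (b - 1) * q ^ 2) = K * ((n - 2) * (n - 3) * (q - 1))"
  proof -
    have "(A * ((b - 1) * (b - 2)) + B * ((a - 1) * (a - 2))) * q ^ 4
        + (A * (b - 1) + B * (a - 1)) * q ^ 3 * (q - (n - 2) * q)
        + (A + B) * q ^ 2 * ((a - 1) * (b - 1) * q ^ 2) = 0"
      unfolding b by algebra
    then show ?thesis unfolding h0 h1 h2 by algebra
  qed
  then have r: "(a - 1) * (b - 1) * q ^ 2 = (n - 2) * (n - 3) * (q - 1)" using K by simp
  \<comment> \<open>The same with the cubic \<open>u (u - (a - 1)) (u - (b - 1))\<close>.\<close>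
  have "K * (n - 2) * ((n - 3) * (n - 4) + 3 * q * (n - 3) + q ^ 2 - (n - 2) * q * (n - 3)
      - (n - 2) * q ^ 2 + (a - 1) * (b - 1) * q ^ 2) = 0"
  proof -
    have "(A * ((b - 1) * (b - 2) * (b - 3)) + B * ((a - 1) * (a - 2) * (a - 3))) * q ^ 5
        + (A * ((b - 1) * (b - 2)) + B * ((a - 1) * (a - 2))) * q ^ 4 * (3 * q - (n - 2) * q)
        + (A * (b - 1) + B * (a - 1)) * q ^ 3
          * (q ^ 2 - (n - 2) * q ^ 2 + (a - 1) * (b - 1) * q ^ 2) = 0"
      unfolding b by algebra
    then show ?thesis unfolding h1 h2 h3 by algebra
  qed
  then have "(n - 3) * (n - 4) + 3 * q * (n - 3) + q ^ 2 - (n - 2) * q * (n - 3)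
      - (n - 2) * q ^ 2 + (a - 1) * (b - 1) * q ^ 2 = 0" using K n by simp
  then have "(n - 3) * ((q - 1) * (q - 2)) = 0" unfolding r by algebra
  then have q2: "q = 2" using n q by simp
  have k: "(b - a) ^ 2 = n - 2" using r unfolding q2 b by algebra
  \<comment> \<open>For \<open>q = 2\<close> the mean of \<open>u\<close> is
    \<open>(n - 2) / 2\<close>, the midpoint of the nodes \<open>a - 1\<close> and
    \<open>b - 1\<close>, so the two weights must coincide.\<close>
  have "4 * ((A - B) * (b - a)) = (A * (b - 1) + B * (a - 1)) * q ^ 3 - (A + B) * q ^ 2 * (n - 2)"
    unfolding q2 b by algebra
  then have "(A - B) * (b - a) = 0" unfolding h0 h1 by simp
  then have "A = B" using ab by simp
  moreover have ab4: "4 * (a * b) = n ^ 2 - n + 2" using k unfolding b by algebra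
  \<comment> \<open>Together with \<open>ab4\<close> this makes \<open>a * b\<close> nonzero, so
    that it cancels from \<open>A = B\<close>.\<close>
  moreover have n2: "n ^ 2 - n > 0"
  proof -
    have "0 < n * (n - 1)" using n by simp
    then show ?thesis by (simp add: power2_eq_square algebra_simps)
  qed
  ultimately have eq: "\<alpha> = \<beta>" unfolding A_def B_def by auto
  have "n * ((1 + \<alpha>) * 2) = n * M" using e1 unfolding eq q2 b by algebra
  then have M2: "M = 2 + 2 * \<alpha>" using n by simp
  have "8 * \<alpha> * (a * b) = n * (n - 1) * M"
    using h0 unfolding A_def B_def K_def eq q2 by algebra
  then have "M = n ^ 2 - n + 2" using ab4 M2 by algebra
  moreover have "\<gamma> = 1" using e0 M2 eq by simp
  ultimately show ?thesis using q2 k by simp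
qed

text \<open>The weights of \<open>lobatto_parameters\<close> are the multiplicities of the agreement
  numbers with one fixed \<open>x\<close>. The last conclusion says that exactly one codeword is the
  complement of \<open>x\<close>.\<close>

lemma design_parameters:
  assumes D: "hamming_design 5 n q C" and n: "n \<ge> 6" and q: "q \<ge> 2" and d: "0 < d" "2 * d < n"
    and x: "x \<in> C" and ag: "\<And>z. z \<in> C \<Longrightarrow> z \<noteq> x \<Longrightarrow> agreement n x z \<in> {d, n - d, 0}"
  shows "q = 2" "(n - 2 * d) ^ 2 + 2 = n" "card C + n = n ^ 2 + 2"
    "card {z \<in> C. agreement n x z = 0} = 1"
proof -
  have finC: "finite C" using design_finite[OF D] .
  define \<alpha> \<beta> \<gamma> where "\<alpha> = card {z \<in> C. agreement n x z = n - d}"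
    and "\<beta> = card {z \<in> C. agreement n x z = d}" and "\<gamma> = card {z \<in> C. agreement n x z = 0}"
  have "{z \<in> C. agreement n x z = n} = {x}"
    using x agreement_eq_length_iff[OF design_wordD[OF D x] design_wordD[OF D]] by blast
  then have one: "card {z \<in> C. agreement n x z = n} = 1" by simp
  have sum_eq: "(\<Sum>z\<in>C. g (agreement n x z)) = g n + \<alpha> * g (n - d) + \<beta> * g d + \<gamma> * g 0"
    for g :: "nat \<Rightarrow> real"
  proof -
    have "agreement n x z \<in> {n, n - d, d, 0}" if "z \<in> C" for z
      using ag[OF that] agreement_self[of n x] by (cases "z = x") auto
    moreover have "distinct [n, n - d, d, 0]" using d by auto
    ultimately show ?thesis
      using sum_four_values[OF finC, of "agreement n x" n "n - d" d 0 g] one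
      unfolding \<alpha>_def \<beta>_def \<gamma>_def by simp
  qed
  \<comment> \<open>The product at node 0 contains the factor 0 as soon as \<open>j > 0\<close>, so
    \<open>\<gamma>\<close> enters only the equation for \<open>j = 0\<close>.\<close>
  have m: "((\<Prod>i<j. real n - real i) + \<alpha> * (\<Prod>i<j. real (n - d) - real i) + \<beta> * (\<Prod>i<j. real d - real i)
      + \<gamma> * (\<Prod>i<j. real 0 - real i)) * real q ^ j = (\<Prod>i<j. real n - real i) * real (card C)"
    if "j \<le> 5" for j
    using sum_agreement_falling[OF D _ x that] n sum_eq[of "\<lambda>w. \<Prod>i<j. real w - real i"] by simp
  have "card C > 0" using x finC card_gt_0_iff by blast
  have e: "1 + real \<alpha> + real \<beta> + real \<gamma> = real (card C)"
    "(real n + \<alpha> * real (n - d) + \<beta> * real d) * real q = real n * real (card C)"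
    using m[of 0] m[of 1] by simp_all
  have prod: "(\<Prod>i<2. r - real i) = r * (r - 1)" "(\<Prod>i<3. r - real i) = r * (r - 1) * (r - 2)"
    "(\<Prod>i<4. r - real i) = r * (r - 1) * (r - 2) * (r - 3)"
    "(\<Prod>i<5. r - real i) = r * (r - 1) * (r - 2) * (r - 3) * (r - 4)" for r :: real
    by (simp_all add: numeral_eq_Suc)
  have "real q = 2 \<and> (real (n - d) - real d) ^ 2 = real n - 2 \<and> real \<gamma> = 1
      \<and> real (card C) = real n ^ 2 - real n + 2"
  proof (rule lobatto_parameters[OF e])
    show "real d + real (n - d) = real n" "real d < real (n - d)" using d by auto
    show "real n \<ge> 6" "real q \<ge> 2" "real (card C) > 0" using n q \<open>card C > 0\<close> by auto
  qed (use m[of 2] m[of 3] m[of 4] m[of 5] in \<open>simp_all only: prod\<close>, simp_all)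
  then have *: "real q = 2" "(real (n - d) - real d) ^ 2 = real n - 2" "real \<gamma> = 1"
    "real (card C) = real n ^ 2 - real n + 2" by auto
  show "q = 2" using *(1) by simp
  have "real ((n - 2 * d) ^ 2 + 2) = real n" using *(2) d by (simp add: of_nat_diff)
  then show "(n - 2 * d) ^ 2 + 2 = n" by (rule of_nat_eq_iff[THEN iffD1])
  have "real (card C + n) = real (n ^ 2 + 2)" using *(4) by simp
  then show "card C + n = n ^ 2 + 2" by (rule of_nat_eq_iff[THEN iffD1])
  show "card {z \<in> C. agreement n x z = 0} = 1" using *(3) unfolding \<gamma>_def by simp
qed

section \<open>Inner products and divisibility\<close>

text \<open>As \<open>y\<close> is neither \<open>x\<close> nor its complement, \<open>u x y\<close>
  is \<open>k\<close> or \<open>- k\<close>. This single factor \<open>k\<close>, compared with the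
  \<open>k * k\<close> dividing all remaining products, leaves one \<open>k\<close> to divide
  \<open>card C - 4 * n\<close>.\<close>

lemma binary_design_dvd:
  assumes D: "hamming_design t n 2 C" and t: "2 \<le> t" "t \<le> n" and d: "0 < d" "2 * d < n"
    and x: "x \<in> C" and y: "y \<in> C" "y \<noteq> x" "agreement n x y \<noteq> 0"
    and ag: "\<And>x z. x \<in> C \<Longrightarrow> z \<in> C \<Longrightarrow> z \<noteq> x \<Longrightarrow> agreement n x z \<in> {d, n - d, 0}"
    and anti: "\<And>x. x \<in> C \<Longrightarrow> card {z \<in> C. agreement n x z = 0} = 1"
  shows "int n - 2 * int d dvd int (card C) - 4 * int n"
proof -
  define k where "k = int n - 2 * int d"
  \<comment> \<open>the inner product of \<open>v\<close> and \<open>z\<close> as sign vectors\<close>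
  define u where "u v z = 2 * int (agreement n v z) - int n" for v z :: "nat \<Rightarrow> nat"
  have k: "0 < k" "k < int n" unfolding k_def using d by auto
  have finC: "finite C" using design_finite[OF D] .
  note W = design_wordD[OF D]
  have lin: "2 * (\<Sum>z\<in>C. int (agreement n v z)) = int n * int (card C)" if "v \<in> C" for v
  proof -
    have "(\<Sum>z\<in>C. agreement n v z) * 2 = n * card C"
      using sum_agreement_choose[OF D t(2) that, of 1] t(1) by simp
    then have "int ((\<Sum>z\<in>C. agreement n v z) * 2) = int (n * card C)" by (rule arg_cong)
    then show ?thesis by simp
  qed
  have "4 * (\<Sum>z\<in>C. int (agreement n x z) * int (agreement n y z))
      = int (4 * (\<Sum>z\<in>C. agreement n x z * agreement n y z))" by simp
  also have "\<dots> = (2 * int (agreement n x y) + int n * (int n - 1)) * int (card C)"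
    unfolding sum_agreement_product[OF D t x y(1)] using d by (simp add: of_nat_diff)
  finally have quad: "4 * (\<Sum>z\<in>C. int (agreement n x z) * int (agreement n y z))
      = (2 * int (agreement n x y) + int n * (int n - 1)) * int (card C)" .
  \<comment> \<open>Centring the agreement numbers cancels the terms without
    \<open>agreement n x y\<close>, up to \<open>- n\<close>: the sign vectors form a tight
    frame.\<close>
  have "(\<Sum>z\<in>C. u x z * u y z) = 4 * (\<Sum>z\<in>C. int (agreement n x z) * int (agreement n y z))
      - int n * (2 * (\<Sum>z\<in>C. int (agreement n x z))) - int n * (2 * (\<Sum>z\<in>C. int (agreement n y z)))
      + int n * int n * int (card C)"
    unfolding u_def by (simp add: algebra_simps sum.distrib sum_subtractf sum_distrib_left)
  also have "\<dots> = u x y * int (card C)"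
    unfolding quad lin[OF x] lin[OF y(1)] u_def by (simp add: algebra_simps)
  finally have total: "(\<Sum>z\<in>C. u x z * u y z) = u x y * int (card C)" .
  have sym: "u v z = u z v" for v z unfolding u_def by (simp add: agreement_commute)
  have self: "u v v = int n" for v unfolding u_def by (simp add: agreement_self)
  have anti_ex: "\<exists>v'\<in>C. agreement n v v' = 0 \<and> (\<forall>z\<in>C. agreement n v z = 0 \<longrightarrow> z = v')"
    if "v \<in> C" for v
  proof -
    obtain v' where v': "{z \<in> C. agreement n v z = 0} = {v'}"
      by (rule card_1_singletonE[OF anti[OF \<open>v \<in> C\<close>]])
    have "z \<in> C \<and> agreement n v z = 0 \<longleftrightarrow> z = v'" for z using arg_cong[OF v', of "(\<in>) z"] by simp
    then show ?thesis by blast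
  qed
  obtain x' where x'C: "x' \<in> C" "agreement n x x' = 0"
    and x'u: "\<And>z. z \<in> C \<Longrightarrow> agreement n x z = 0 \<Longrightarrow> z = x'" using anti_ex[OF x] by blast
  obtain y' where y'C: "y' \<in> C" "agreement n y y' = 0"
    and y'u: "\<And>z. z \<in> C \<Longrightarrow> agreement n y z = 0 \<Longrightarrow> z = y'" using anti_ex[OF y(1)] by blast
  have u0: "u x x' = - int n" "u y y' = - int n" unfolding u_def using x'C y'C by auto
  have uc: "u y x' = - u x y" "u x y' = - u x y"
    using agreement_complement[OF W[OF x] W[OF y(1)] W[OF x'C(1)] x'C(2)]
      agreement_complement[OF W[OF y(1)] W[OF x] W[OF y'C(1)] y'C(2)]
    unfolding u_def by (auto simp: agreement_commute[of n y x])
  have uk: "u v z = k \<or> u v z = - k" if "v \<in> C" "z \<in> C" "z \<noteq> v" "agreement n v z \<noteq> 0" for v z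
    using ag[OF that(1-3)] that(4) d unfolding u_def k_def by auto
  have s: "u x y = k \<or> u x y = - k" using uk[OF x y] .
  \<comment> \<open>\<open>u x\<close> takes the values \<open>n\<close>, \<open>- n\<close> at
    \<open>x\<close>, \<open>x'\<close> and absolute value \<open>k < n\<close> at \<open>y\<close>,
    \<open>y'\<close>; the latter two are separated by \<open>u y\<close>.\<close>
  have dist: "distinct [x, x', y, y']"
  proof -
    have "u x x > k" "u x x' < - k" "u x y \<in> {k, - k}" "u x y' \<in> {k, - k}"
      "u y x \<noteq> u y x'" "u y y \<noteq> u y y'"
      unfolding self u0 uc sym[of y x] using s k by auto
    then show ?thesis using k by auto
  qed
  define R where "R = C - {x, x', y, y'}"
  have "{x, x', y, y'} \<union> R = C" unfolding R_def using x y(1) x'C(1) y'C(1) by blast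
  then have "(\<Sum>z\<in>C. u x z * u y z) = (\<Sum>z\<in>{x, x', y, y'}. u x z * u y z) + (\<Sum>z\<in>R. u x z * u y z)"
    using sum.union_disjoint[of "{x, x', y, y'}" R "\<lambda>z. u x z * u y z"] finC
    unfolding R_def by auto
  \<comment> \<open>Passing to a complement negates both factors, so each of the four terms is
    \<open>n * u x y\<close>.\<close>
  also have "(\<Sum>z\<in>{x, x', y, y'}. u x z * u y z) = 4 * int n * u x y"
    using dist self[of x] self[of y] u0 uc sym[of y x] by simp
  finally have "u x y * (int (card C) - 4 * int n) = (\<Sum>z\<in>R. u x z * u y z)"
    using total by (simp add: algebra_simps)
  moreover have "k * k dvd (\<Sum>z\<in>R. u x z * u y z)"
  proof (rule dvd_sum)
    fix z assume z: "z \<in> R"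
    then have "z \<in> C" "z \<noteq> x" "z \<noteq> y" "agreement n x z \<noteq> 0" "agreement n y z \<noteq> 0"
      unfolding R_def using x'u y'u by auto
    then have "u x z = k \<or> u x z = - k" "u y z = k \<or> u y z = - k" using uk[OF x] uk[OF y(1)] by auto
    then show "k * k dvd u x z * u y z" by auto
  qed
  ultimately have "k * k dvd u x y * (int (card C) - 4 * int n)" by simp
  then have "k * k dvd k * (int (card C) - 4 * int n)" using s by auto
  then show ?thesis using k unfolding k_def[symmetric] by simp
qed

section \<open>Identification of the even weight code\<close>

lemma relabel_dual_binary_repetition_code:
  "relabel n (dual_code n (binary_repetition_code n))
    = {y \<in> words n 2. even (card {i \<in> {1..n}. y i \<noteq> 1})}"
proof (intro equalityI subsetI)
  fix y assume "y \<in> relabel n (dual_code n (binary_repetition_code n))"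
  then obtain x where x: "x \<in> binary_words n" "even (card {i \<in> {1..n}. x i = 1})"
    and y: "y = (\<lambda>i\<in>{1..n}. symbol_of_bit (x i))"
    unfolding relabel_def dual_binary_repetition_code by auto
  have "{i \<in> {1..n}. y i \<noteq> 1} = {i \<in> {1..n}. x i = 1}"
    unfolding y symbol_of_bit_def by auto
  then show "y \<in> {y \<in> words n 2. even (card {i \<in> {1..n}. y i \<noteq> 1})}"
    using x(2) unfolding y words_def symbol_of_bit_def by auto
next
  fix y assume y: "y \<in> {y \<in> words n 2. even (card {i \<in> {1..n}. y i \<noteq> 1})}"
  define x :: "nat \<Rightarrow> bit" where "x = (\<lambda>i\<in>{1..n}. if y i = 1 then 0 else 1)"
  have "{i \<in> {1..n}. x i = 1} = {i \<in> {1..n}. y i \<noteq> 1}" unfolding x_def by auto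
  then have "x \<in> dual_code n (binary_repetition_code n)"
    using y unfolding dual_binary_repetition_code binary_words_def x_def by auto
  moreover have "y = (\<lambda>i\<in>{1..n}. symbol_of_bit (x i))"
  proof
    fix i
    show "y i = (\<lambda>i\<in>{1..n}. symbol_of_bit (x i)) i"
    proof (cases "i \<in> {1..n}")
      case True
      then have "y i \<in> {1..2}" using words_symbolD[of y n 2] y by blast
      then show ?thesis using True unfolding x_def symbol_of_bit_def by auto
    next
      case False
      then show ?thesis using words_undefined[of y n 2 i] y by auto
    qed
  qed
  ultimately show "y \<in> relabel n (dual_code n (binary_repetition_code n))"
    unfolding relabel_def by blast
qed

text \<open>By strength \<open>t\<close> every pattern on the first \<open>t\<close> coordinates
  extends to a codeword, and evenness of the distance to \<open>c0\<close> determines its last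
  symbol. Hence \<open>C\<close> consists of all words at even distance from
  \<open>c0\<close>.\<close>

lemma even_distance_design_isomorphic:
  assumes D: "hamming_design t (Suc t) 2 C"
    and ev: "\<And>x y. x \<in> C \<Longrightarrow> y \<in> C \<Longrightarrow> even (hamming_dist (Suc t) x y)"
  shows "code_isomorphic (Suc t) 2 C
    (relabel (Suc t) (dual_code (Suc t) (binary_repetition_code (Suc t))))"
proof -
  let ?n = "Suc t"
  obtain c0 where c0: "c0 \<in> C" using D unfolding hamming_design_def by auto
  \<comment> \<open>relabelling that turns \<open>c0\<close> into the constant word 1, i.e. into the zero vector\<close>
  define \<sigma> where "\<sigma> i = Transposition.transpose 1 (c0 i)" for i
  \<comment> \<open>The \<open>id\<close> gives \<open>\<phi>\<close> the form demanded by
    \<open>code_isomorphic\<close>, with the trivial permutation of coordinates.\<close>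
  define \<phi> where "\<phi> = (\<lambda>x. \<lambda>i\<in>{1..?n}. \<sigma> i (x (id i)))"
  have \<sigma>: "\<sigma> i permutes {1..2}" if "i \<in> {1..?n}" for i
    unfolding \<sigma>_def using design_symbolD[OF D c0 that] by (intro permutes_swap_id) auto
  have \<sigma>1: "\<sigma> i c = 1 \<longleftrightarrow> c = c0 i" for i c
    unfolding \<sigma>_def by (auto simp: transpose_def)
  have \<sigma>2: "\<sigma> i (\<sigma> i c) = c" for i c unfolding \<sigma>_def by simp
  have \<phi>w: "\<phi> x \<in> words ?n 2" if x: "x \<in> words ?n 2" for x
  proof -
    have "\<sigma> i (x i) \<in> {1..2}" if i: "i \<in> {1..?n}" for i
      using permutes_in_image[OF \<sigma>[OF i]] words_symbolD[OF x i] by blast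
    then show ?thesis unfolding words_def \<phi>_def by simp
  qed
  have \<phi>d: "card {i \<in> {1..?n}. \<phi> x i \<noteq> 1} = hamming_dist ?n x c0" for x
    unfolding hamming_dist_def \<phi>_def by (intro arg_cong[where f = card]) (use \<sigma>1 in auto)
  have \<phi>\<phi>: "\<phi> (\<phi> x) = x" if "x \<in> words ?n 2" for x
  proof
    fix i
    show "\<phi> (\<phi> x) i = x i"
      using words_undefined[OF that, of i] \<sigma>2 unfolding \<phi>_def by (cases "i \<in> {1..?n}") simp_all
  qed
  have "\<phi> ` C = {y \<in> words ?n 2. even (card {i \<in> {1..?n}. y i \<noteq> 1})}"
  proof (intro equalityI subsetI)
    fix y assume "y \<in> \<phi> ` C"
    then show "y \<in> {y \<in> words ?n 2. even (card {i \<in> {1..?n}. y i \<noteq> 1})}"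
      using \<phi>w \<phi>d ev[OF _ c0] design_wordD[OF D] by auto
  next
    fix y assume y: "y \<in> {y \<in> words ?n 2. even (card {i \<in> {1..?n}. y i \<noteq> 1})}"
    \<comment> \<open>\<open>\<phi>\<close> is an involution on words, so \<open>v\<close> is the
      preimage of \<open>y\<close>.\<close>
    define v where "v = \<phi> y"
    have v: "v \<in> words ?n 2" "\<phi> v = y" "even (hamming_dist ?n v c0)"
      unfolding v_def using y \<phi>w \<phi>\<phi> \<phi>d[of v] unfolding v_def by auto
    have vs: "v i \<in> {1..2}" if "i \<in> {1..?n}" for i
      using words_symbolD[OF v(1) that] .
    have "card {z \<in> C. \<forall>i\<in>{1..t}. z i = v i} * 2 ^ t = card C"
      by (rule design_count_full[OF D]) (use vs in auto)
    then have "{z \<in> C. \<forall>i\<in>{1..t}. z i = v i} \<noteq> {}"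
      using c0 design_finite[OF D] by (metis card.empty card_gt_0_iff empty_iff less_irrefl mult_0)
    then obtain z where z: "z \<in> C" "\<And>i. i \<in> {1..t} \<Longrightarrow> z i = v i" by auto
    define P where "P = card {i \<in> {1..t}. v i \<noteq> c0 i}"
    \<comment> \<open>The first \<open>t\<close> coordinates contribute the same \<open>P\<close>
      for \<open>z\<close> and \<open>v\<close>, so the parities decide whether the last symbol
      equals that of \<open>c0\<close>.\<close>
    have last: "hamming_dist ?n r c0 = P + (if r ?n = c0 ?n then 0 else 1)"
      if "\<And>i. i \<in> {1..t} \<Longrightarrow> r i = v i" for r
    proof -
      have "{i \<in> {1..?n}. r i \<noteq> c0 i}
          = {i \<in> {1..t}. v i \<noteq> c0 i} \<union> (if r ?n = c0 ?n then {} else {?n})"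
        using that by (auto simp: atLeastAtMostSuc_conv)
      then show ?thesis unfolding hamming_dist_def P_def by (auto simp: card_insert_if)
    qed
    have "z ?n = c0 ?n \<longleftrightarrow> v ?n = c0 ?n"
      using last[of z, OF z(2)] last[of v] ev[OF z(1) c0] v(3) by (auto split: if_splits)
    moreover have "z ?n \<in> {1..2}" "v ?n \<in> {1..2}" "c0 ?n \<in> {1..2}"
      using vs design_symbolD[OF D z(1)] design_symbolD[OF D c0] by auto
    ultimately have "z ?n = v ?n" by auto
    then have "z i = v i" if "i \<in> {1..?n}" for i
      using z(2) that by (cases "i = ?n") auto
    then have "z = v"
      using design_wordD[OF D z(1)] v(1) unfolding words_def by (intro PiE_ext) auto
    then show "y \<in> \<phi> ` C" using z(1) v(2) by (metis imageI)
  qed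
  then show ?thesis
    unfolding code_isomorphic_def relabel_dual_binary_repetition_code
    using \<sigma> permutes_id unfolding \<phi>_def by metis
qed

section \<open>Elimination of the remaining parameters\<close>

theorem theorem4p12:
  fixes n q :: nat and a :: int and C :: "(nat \<Rightarrow> nat) set"
  assumes "n \<ge> 6" and "q \<ge> 2"
    and "hamming_design 5 n q C"
    and "code_degree n C = 3"
    and "int ` degree_set n C = {a, int n - a, int n}"
    and "real_of_int a < real n / 2"
  shows "n = 6 \<and> q = 2 \<and>
    code_isomorphic n q C (relabel 6 (dual_code 6 (binary_repetition_code 6)))"
proof -
  note n = assms(1) and D = assms(3)
  note W = design_wordD[OF D]
  have "a \<in> int ` degree_set n C" using assms(5) by simp
  \<comment> \<open>Realising \<open>a\<close> as a distance makes it a positive natural number; the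
    same pair later serves in \<open>binary_design_dvd\<close>.\<close>
  then obtain x y where xy: "x \<in> C" "y \<in> C" "y \<noteq> x" and a: "a = int (hamming_dist n x y)"
    unfolding degree_set_def by auto
  define d where "d = hamming_dist n x y"
  have "agreement n x y \<noteq> n" using agreement_eq_length_iff[OF W W] xy by blast
  then have d: "0 < d" "2 * d < n"
    using agreement_add_hamming_dist[of n x y] assms(6) unfolding d_def a by auto
  have dist: "hamming_dist n v z \<in> {d, n - d, n}" if "v \<in> C" "z \<in> C" "z \<noteq> v" for v z
  proof -
    have "int (hamming_dist n v z) \<in> int ` degree_set n C"
      using that unfolding degree_set_def by blast
    then have "int (hamming_dist n v z) \<in> {int d, int n - int d, int n}"
      unfolding assms(5) a d_def .
    then show ?thesis using d by auto
  qed
  have ag: "agreement n v z \<in> {d, n - d, 0}" if "v \<in> C" "z \<in> C" "z \<noteq> v" for v z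
    using dist[OF that] agreement_add_hamming_dist[of n v z] d by auto
  note P = design_parameters[OF D n assms(2) d]
  have q: "q = 2" and k2: "(n - 2 * d) ^ 2 + 2 = n" and M: "card C + n = n ^ 2 + 2"
    using P(1-3)[OF xy(1) ag[OF xy(1)]] by blast+
  define k where "k = n - 2 * d"
  have nk: "n = k ^ 2 + 2" using k2[symmetric] unfolding k_def .
  have "int n - 2 * int d dvd int (card C) - 4 * int n"
  proof (rule binary_design_dvd[OF _ _ _ d xy(1) xy(2) xy(3)])
    show "hamming_design 5 n 2 C" using D q by simp
    show "agreement n x y \<noteq> 0" using agreement_add_hamming_dist[of n x y] d unfolding d_def by auto
    show "(2::nat) \<le> 5" "5 \<le> n" using n by auto
    show "agreement n v z \<in> {d, n - d, 0}" if "v \<in> C" "z \<in> C" "z \<noteq> v" for v z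
      using ag[OF that] .
    show "card {z \<in> C. agreement n v z = 0} = 1" if "v \<in> C" for v
      using P(4)[OF that ag[OF that]] .
  qed
  moreover have "int n - 2 * int d = int k" unfolding k_def using d by simp
  \<comment> \<open>With \<open>n = k ^ 2 + 2\<close> the size is
    \<open>k ^ 4 + 3 * k ^ 2 + 4\<close>.\<close>
  moreover have "int (card C) - 4 * int n = int k * (int k ^ 3 - int k) - 4"
  proof -
    have "int (card C) + int n = int n ^ 2 + 2" using arg_cong[OF M, of int] by simp
    then show ?thesis unfolding nk by (simp add: algebra_simps power2_eq_square power3_eq_cube)
  qed
  ultimately have "int k dvd int k * (int k ^ 3 - int k) - 4" by simp
  then have "int k dvd 4" by (simp add: dvd_diff_right_iff)
  then have "k dvd 4" by (metis of_nat_dvd_iff of_nat_numeral)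
  then have "k \<le> 4" by (rule dvd_imp_le) simp
  then have "k \<in> {0, 1, 2, 3, 4}" by auto
  moreover have "k \<noteq> 0" "k \<noteq> 1" using nk n by (auto simp: power2_eq_square intro: Nat.gr0I)
  moreover have "k \<noteq> 3" using \<open>k dvd 4\<close> by auto
  \<comment> \<open>Here \<open>n = 18\<close>, and strength 5 would require 32 to divide
    308.\<close>
  moreover have "k \<noteq> 4"
  proof
    assume "k = 4"
    then have "card C = 308" using M nk by simp
    moreover have "card {z \<in> C. \<forall>i\<in>{1..5}. z i = x i} * 2 ^ 5 = card C"
      by (rule design_count_full[OF D[unfolded q]])
        (use n design_symbolD[OF D[unfolded q] xy(1)] in auto)
    ultimately have "card {z \<in> C. \<forall>i\<in>{1..5}. z i = x i} * 32 = 308" by simp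
    then show False by presburger
  qed
  ultimately have "k = 2" by auto
  then have n6: "n = 6" using nk by simp
  \<comment> \<open>The possible distances are now 2, 4 and 6.\<close>
  then have d2: "d = 2" using \<open>k = 2\<close> unfolding k_def by simp
  have "code_isomorphic (Suc 5) 2 C (relabel (Suc 5) (dual_code (Suc 5) (binary_repetition_code (Suc 5))))"
  proof (rule even_distance_design_isomorphic)
    show "hamming_design 5 (Suc 5) 2 C" using D n6 q by simp
    show "even (hamming_dist (Suc 5) v z)" if "v \<in> C" "z \<in> C" for v z
      using dist[OF that] n6 d2 by (cases "z = v") (auto simp: hamming_dist_def)
  qed
  then show ?thesis using n6 q by simp
qed

end
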